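(* Let $n>1$ and let $$D^{n,1}=\{(z_0,\dots,z_n)\in\mathbb{C}^{n+1}: -|z_0|^2+|z_1|^2+\cdots+|z_n|^2>0\}.$$ There is no discrete subgroup $\Gamma$ of $\mathrm{Aut}(D^{n,1})$ acting properly discontinuously on $D^{n,1}$ such that the quotient $D^{n,1}/\Gamma$ is compact.
   Context: $\mathrm{Aut}(D^{n,1})$ denotes the group of all biholomorphic self-maps of $D^{n,1}$ with the compact-open topology. *)

theory Defs
  imports "HOL-Analysis.Analysis"
begin

text \<open>Points of C^(n+1) are vectors of type complex^'n with CARD('n) = n+1.
  The distinguished coordinate z_0 is the index e0.\<close>

definition Dn1 :: "'n::finite \<Rightarrow> (complex^'n) set" where
  "Dn1 e0 = {z. - (cmod (z $ e0))\<^sup>2 + (\<Sum>i\<in>UNIV - {e0}. (cmod (z $ i))\<^sup>2) > 0}"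

definition holo_on :: "(complex^'n::finite) set \<Rightarrow> (complex^'n \<Rightarrow> complex^'n) \<Rightarrow> bool" where
  "holo_on S f \<longleftrightarrow> (\<forall>x\<in>S. \<exists>L. (f has_derivative L) (at x) \<and>
        (\<forall>c v. L (c *s v) = c *s L v))"

text \<open>Automorphisms (biholomorphic self-maps) of an open set S.  Maps are normalised
  to be the identity outside S so that they form a group under composition.\<close>
definition aut_inv :: "(complex^'n::finite) set \<Rightarrow> (complex^'n \<Rightarrow> complex^'n) \<Rightarrow> complex^'n \<Rightarrow> complex^'n" where
  "aut_inv S f = (\<lambda>z. if z \<in> S then inv_into S f z else z)"

definition Aut :: "(complex^'n::finite) set \<Rightarrow> (complex^'n \<Rightarrow> complex^'n) set" where
  "Aut S = {f. bij_betw f S S \<and> holo_on S f \<and> holo_on S (aut_inv S f) \<and> (\<forall>z. z \<notin> S \<longrightarrow> f z = z)}"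

definition aut_subgroup :: "(complex^'n::finite) set \<Rightarrow> (complex^'n \<Rightarrow> complex^'n) set \<Rightarrow> bool" where
  "aut_subgroup S G \<longleftrightarrow> G \<subseteq> Aut S \<and> id \<in> G \<and> (\<forall>f\<in>G. \<forall>g\<in>G. f \<circ> g \<in> G) \<and>
     (\<forall>f\<in>G. aut_inv S f \<in> G)"

definition compact_open_aut :: "(complex^'n::finite) set \<Rightarrow> (complex^'n \<Rightarrow> complex^'n) topology" where
  "compact_open_aut S = subtopology
     (topology_generated_by {{f. f ` K \<subseteq> U} | K U. compact K \<and> K \<subseteq> S \<and> open U}) (Aut S)"

definition discrete_in_aut :: "(complex^'n::finite) set \<Rightarrow> (complex^'n \<Rightarrow> complex^'n) set \<Rightarrow> bool" where
  "discrete_in_aut S G \<longleftrightarrow> (\<forall>g\<in>G. \<exists>V. openin (compact_open_aut S) V \<and> V \<inter> G = {g})"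

definition properly_discontinuous :: "(complex^'n::finite) set \<Rightarrow> (complex^'n \<Rightarrow> complex^'n) set \<Rightarrow> bool" where
  "properly_discontinuous S G \<longleftrightarrow>
     (\<forall>K. compact K \<and> K \<subseteq> S \<longrightarrow> finite {g\<in>G. g ` K \<inter> K \<noteq> {}})"

definition orbit_map :: "(complex^'n::finite \<Rightarrow> complex^'n) set \<Rightarrow> complex^'n \<Rightarrow> (complex^'n) set" where
  "orbit_map G x = {g x | g. g \<in> G}"

definition compact_quotient :: "(complex^'n::finite) set \<Rightarrow> (complex^'n \<Rightarrow> complex^'n) set \<Rightarrow> bool" where
  "compact_quotient S G \<longleftrightarrow>
     (\<exists>Y. quotient_map (top_of_set S) Y (orbit_map G) \<and> compact_space Y)"

end

theory Submission
  imports Defs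
    "HOL-Complex_Analysis.Great_Picard"
    "HOL-Complex_Analysis.Meromorphic"
    "HOL-Computational_Algebra.Fundamental_Theorem_Algebra"
begin

text \<open>
  Let q be the form whose positive cone is Dn1.  Replacing z by z + w * axis e1 1 and integrating
  over a large circle in w extends a holomorphic map from Dn1 to the whole space; a third coordinate
  e2 connects each point of Dn1 to points where Cauchy's formula shows that the integral is the
  given map.  An automorphism therefore extends to a bijection F that preserves the cone q \<le> 0.
  On a complex line through 0 in this cone every component of F is dominated by the component e0,
  hence a multiple of it, and the component e0 is an injective entire function, hence affine.  So F
  fixes 0 and is homogeneous, which forces it to be linear, and a linear map preserving the
  positive cone of q multiplies q by a constant \<mu> there.

  As in the Calabi--Markus phenomenon, F maps some unit vector of the positive definite hyperplane
  z $ e0 = 0 into that hyperplane, where q is the squared norm.  So in a properly discontinuous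
  group only finitely many elements have \<mu> in a given compact subset of the positive reals.  If the
  quotient were compact, the unbounded level set q = 1 would be covered by the images of one compact
  set under finitely many elements.

  Holomorphy in several variables is expressed through composition with holomorphic curves, which
  is stable under composition of maps and reduces everything to functions of one variable.
\<close>

no_notation fps_nth (infixl \<open>$\<close> 75)

section \<open>Holomorphic functions of one variable\<close>

lemma continuous_on_contour_integral_param:
  fixes f :: "'a::topological_space \<Rightarrow> complex \<Rightarrow> complex"
  assumes "continuous_on (U \<times> path_image \<gamma>) (\<lambda>(x, w). f x w)" and "valid_path \<gamma>"
    and "continuous_on {0..1} (\<lambda>s. vector_derivative \<gamma> (at s))"
  shows "continuous_on U (\<lambda>x. contour_integral \<gamma> (f x))"
proof -
  have "continuous_on (U \<times> {0..1}) (\<lambda>p. \<gamma> (snd p))"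
    using assms(2) by (auto intro!: continuous_on_compose2 [of "{0..1}" \<gamma>] continuous_intros
        simp: valid_path_def piecewise_C1_differentiable_on_def)
  then have "continuous_on (U \<times> {0..1}) (\<lambda>p. (fst p, \<gamma> (snd p)))"
    by (intro continuous_intros)
  then have "continuous_on (U \<times> {0..1}) (\<lambda>p. f (fst p) (\<gamma> (snd p)))"
    using continuous_on_compose2 [OF assms(1), of "U \<times> {0..1}" "\<lambda>p. (fst p, \<gamma> (snd p))"]
    by (fastforce simp: path_image_def)
  moreover have "continuous_on (U \<times> {0..1}) (\<lambda>p. vector_derivative \<gamma> (at (snd p)))"
    by (intro continuous_on_compose2 [OF assms(3)] continuous_intros) auto
  ultimately have "continuous_on (U \<times> cbox 0 1)
      (\<lambda>(x, s). f x (\<gamma> s) * vector_derivative \<gamma> (at s))"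
    by (auto simp: split_def intro: continuous_on_mult)
  then show ?thesis
    unfolding contour_integral_integral box_real [symmetric] by (rule integral_continuous_on_param)
qed

lemma Cauchy_integral_circlepath_param:
  assumes hol: "\<And>w. w \<in> path_image \<gamma> \<Longrightarrow> (\<lambda>t. f t w) holomorphic_on cball z r"
    and cont: "continuous_on (cball z r \<times> path_image \<gamma>) (\<lambda>(t, w). f t w)"
    and \<gamma>: "valid_path \<gamma>" "continuous_on {0..1} (\<lambda>s. vector_derivative \<gamma> (at s))"
    and t: "t \<in> ball z r"
  shows "contour_integral (circlepath z r) (\<lambda>s. contour_integral \<gamma> (f s) / (s - t))
    = 2 * of_real pi * \<i> * contour_integral \<gamma> (f t)"
proof -
  let ?C = "circlepath z r"
  have r: "0 < r"
    using t by (auto intro: le_less_trans [OF zero_le_dist])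
  have mult_left: "contour_integral \<gamma> (\<lambda>w. c * g w) = c * contour_integral \<gamma> g" for c g
    by (simp add: contour_integral_integral mult.assoc)
  have "contour_integral ?C (\<lambda>s. contour_integral \<gamma> (f s) / (s - t))
      = contour_integral ?C (\<lambda>s. contour_integral \<gamma> (\<lambda>w. f s w / (s - t)))"
    using mult_left [of "inverse _"] by (simp add: divide_inverse mult.commute)
  also have "\<dots> = contour_integral \<gamma> (\<lambda>w. contour_integral ?C (\<lambda>s. f s w / (s - t)))"
  proof (rule contour_integral_swap [OF _ _ \<gamma>(1) _ \<gamma>(2)])
    have "continuous_on (path_image ?C \<times> path_image \<gamma>) (\<lambda>(s, w). f s w)"
      using r by (intro continuous_on_subset [OF cont]) auto
    moreover have "s - t \<noteq> 0" if "s \<in> path_image ?C" for s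
      using that t r by (auto simp: dist_commute)
    ultimately show "continuous_on (path_image ?C \<times> path_image \<gamma>) (\<lambda>(s, w). f s w / (s - t))"
      by (auto simp: split_def intro!: continuous_intros)
    show "continuous_on {0..1} (\<lambda>s. vector_derivative ?C (at s))"
      unfolding vector_derivative_circlepath by (intro continuous_intros)
  qed auto
  also have "\<dots> = contour_integral \<gamma> (\<lambda>w. 2 * of_real pi * \<i> * f t w)"
    using hol t by (intro contour_integral_eq contour_integral_unique
        Cauchy_integral_circlepath_simple) (auto simp: dist_norm norm_minus_commute)
  finally show ?thesis
    by (simp only: mult_left)
qed

lemma holomorphic_on_contour_integral_param:
  assumes U: "open U" and cont: "continuous_on (U \<times> path_image \<gamma>) (\<lambda>(t, w). f t w)"
    and hol: "\<And>w. w \<in> path_image \<gamma> \<Longrightarrow> (\<lambda>t. f t w) holomorphic_on U"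
    and \<gamma>: "valid_path \<gamma>" "continuous_on {0..1} (\<lambda>s. vector_derivative \<gamma> (at s))"
  shows "(\<lambda>t. contour_integral \<gamma> (f t)) holomorphic_on U"
  unfolding holomorphic_on_open [OF U]
proof
  fix z assume "z \<in> U"
  then obtain r where r: "0 < r" "cball z r \<subseteq> U"
    using U open_contains_cball by blast
  define I where "I t = contour_integral \<gamma> (f t)" for t
  have contI: "continuous_on (path_image (circlepath z r)) I"
    unfolding I_def using r
    by (intro continuous_on_subset [OF continuous_on_contour_integral_param [OF cont \<gamma>]]) auto
  have "((\<lambda>s. I s / (s - t) ^ 1) has_contour_integral 2 * of_real pi * \<i> * I t) (circlepath z r)"
    if t: "t \<in> ball z r" for t
  proof -
    have "s - t \<noteq> 0" if "s \<in> path_image (circlepath z r)" for s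
      using that t r by (auto simp: dist_commute)
    then have "(\<lambda>s. I s / (s - t)) contour_integrable_on circlepath z r"
      using contI by (intro contour_integrable_continuous_circlepath continuous_intros) auto
    moreover have "contour_integral (circlepath z r) (\<lambda>s. I s / (s - t))
        = 2 * of_real pi * \<i> * I t"
      unfolding I_def using hol cont r \<gamma> t
      by (intro Cauchy_integral_circlepath_param)
        (auto intro: holomorphic_on_subset continuous_on_subset)
    ultimately show ?thesis
      using has_contour_integral_integral by fastforce
  qed
  then obtain I' where "((\<lambda>t. 2 * of_real pi * \<i> * I t) has_field_derivative I') (at z)"
    using Cauchy_next_derivative_circlepath(2) [OF contI, of 1 "\<lambda>t. 2 * of_real pi * \<i> * I t" z] r
    by auto
  then show "\<exists>I'. ((\<lambda>t. contour_integral \<gamma> (f t)) has_field_derivative I') (at z)"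
    using DERIV_cdivide [where c = "2 * of_real pi * \<i>"] unfolding I_def by fastforce
qed

lemma bounded_meromorphic_on_UNIV_imp_constant:
  assumes mero: "q meromorphic_on UNIV" and bound: "\<And>t. norm (q t) \<le> B"
  shows "remove_sings q constant_on UNIV"
proof -
  have sing: "isolated_singularity_at q z" "not_essential q z" for z
    using meromorphic_on_subset [OF mero, of "{z}"]
    by (auto intro: meromorphic_on_isolated_singularity meromorphic_on_not_essential)
  have "\<not> is_pole q z" for z
  proof
    assume "is_pole q z"
    then have "\<forall>\<^sub>F w in at z. \<bar>B\<bar> + 1 \<le> norm (q w)"
      using filterlim_at_infinity [OF order_refl, of q "at z"] by (simp add: is_pole_def)
    then obtain w where "\<bar>B\<bar> + 1 \<le> norm (q w)"
      using eventually_happens' [OF at_neq_bot] by blast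
    then show False
      using bound [of w] by simp
  qed
  then have lim: "q \<midarrow>z\<rightarrow> remove_sings q z" for z
    using sing(2) [of z] remove_sings_eqI unfolding not_essential_def by metis
  then have "remove_sings q holomorphic_on UNIV"
    using remove_sings_analytic_at [OF sing(1)] analytic_on_analytic_at analytic_imp_holomorphic
    by blast
  moreover have "norm (remove_sings q z) \<le> B" for z
    using lim [of z] bound by (intro Lim_norm_ubound [of "at z" q]) auto
  then have "bounded (range (remove_sings q))"
    by (auto intro: boundedI)
  ultimately show ?thesis
    by (rule Liouville_theorem)
qed

lemma entire_norm_le_imp_proportional:
  assumes f: "f holomorphic_on UNIV" and g: "g holomorphic_on UNIV"
    and norm_le: "\<And>t. norm (f t) \<le> norm (g t)"
  shows "\<exists>c. \<forall>t. f t = c * g t"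
proof -
  define q where "q t = f t / g t" for t
  have analytic: "f analytic_on UNIV" "g analytic_on UNIV"
    using f g by (auto simp: analytic_on_open)
  have "q meromorphic_on UNIV"
    unfolding q_def using analytic by (intro meromorphic_intros analytic_on_imp_meromorphic_on)
  moreover have "norm (q t) \<le> 1" for t
    using norm_le [of t] by (cases "g t = 0") (auto simp: q_def norm_divide divide_le_eq_1)
  ultimately have "remove_sings q constant_on UNIV"
    by (rule bounded_meromorphic_on_UNIV_imp_constant)
  then obtain c where remove_sings_q: "\<And>z. remove_sings q z = c"
    by (auto simp: constant_on_def)
  have "f t = c * g t" for t
  proof (cases "g t = 0")
    case False
    then have "q analytic_on {t}"
      unfolding q_def using analytic by (intro analytic_intros) (auto intro: analytic_on_subset)
    then show ?thesis
      using remove_sings_q [of t] False by (auto simp: q_def)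
  qed (use norm_le [of t] in simp)
  then show ?thesis
    by blast
qed

lemma injective_entire_not_essential_at_infinity:
  assumes f: "f holomorphic_on UNIV" and inj: "inj f"
  obtains l where "((inverse \<circ> f) \<longlongrightarrow> l) at_infinity"
proof -
  have hol: "(f \<circ> inverse) holomorphic_on UNIV - {0}"
    by (intro holomorphic_on_compose_gen [OF _ f] holomorphic_intros) auto
  have no_lim: "\<not> ((f \<circ> inverse) \<longlongrightarrow> l) (at 0)" for l
  proof
    assume "((f \<circ> inverse) \<longlongrightarrow> l) (at 0)"
    then have "f z = l" for z
      by (intro Liouville_weak [OF f]) (simp add: lim_at_infinity_0)
    then show False
      using injD [OF inj, of 0 1] by simp
  qed
  have "\<exists>l. ((inverse \<circ> (f \<circ> inverse)) \<longlongrightarrow> l) (at 0)"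
  proof (rule ccontr)
    define fibre where "fibre w = {x. x \<in> UNIV - {0} \<and> (f \<circ> inverse) x = w}" for w
    assume "\<nexists>l. ((inverse \<circ> (f \<circ> inverse)) \<longlongrightarrow> l) (at 0)"
    then obtain a where infinite_fibre: "\<And>w. w \<noteq> a \<Longrightarrow> infinite (fibre w)"
      using great_Picard_infinite [OF open_UNIV UNIV_I hol no_lim] unfolding fibre_def by metis
    have "fibre (f 0) \<subseteq> {1}" "fibre (f 1) \<subseteq> {1}"
      unfolding fibre_def using inj by (auto dest!: injD)
    then have "finite (fibre (f 0))" "finite (fibre (f 1))"
      by (auto intro: finite_subset)
    then have "f 0 = f 1"
      using infinite_fibre by metis
    then show False
      using injD [OF inj, of 0 1] by simp
  qed
  then show ?thesis
    using that by (auto simp: lim_at_infinity_0 comp_assoc)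
qed

lemma injective_entire_imp_affine:
  assumes f: "f holomorphic_on UNIV" and inj: "inj f"
  obtains a b where "\<And>t. f t = a + t * b" "b \<noteq> 0"
proof -
  obtain l where "((inverse \<circ> f) \<longlongrightarrow> l) at_infinity"
    using injective_entire_not_essential_at_infinity [OF assms] .
  then obtain a n where "\<And>t. f t = (\<Sum>i\<le>n. a i * t ^ i)"
    using pole_at_infinity [OF f] by blast
  then have "f = poly (\<Sum>i\<le>n. monom (a i) i)"
    by (auto simp: poly_sum poly_monom)
  then obtain p where f_eq_poly: "f = poly p"
    by blast
  have "poly (pderiv p) t \<noteq> 0" for t
    using holomorphic_injective_imp_regular [OF f open_UNIV inj, of t]
    by (simp add: f_eq_poly DERIV_imp_deriv [OF poly_DERIV])
  then obtain c where "pderiv p = [:c:]"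
    using fundamental_theorem_of_algebra_alt [of "pderiv p"] by metis
  then have "degree p \<le> 1"
    using degree_pderiv [of p] by simp
  obtain a r where p_eq: "p = pCons a r"
    by (cases p)
  then have "degree r = 0"
    using \<open>degree p \<le> 1\<close> by (auto split: if_splits)
  then obtain b where "p = [:a, b:]"
    using p_eq degree0_coeffs by blast
  then have "f t = a + t * b" for t
    by (simp add: f_eq_poly)
  moreover have "b \<noteq> 0"
    using calculation [of 0] calculation [of 1] injD [OF inj, of 0 1] by auto
  ultimately show ?thesis ..
qed

section \<open>Maps that are holomorphic along holomorphic curves\<close>

definition holomorphic_curve :: "complex set \<Rightarrow> (complex \<Rightarrow> complex^'n::finite) \<Rightarrow> bool" where
  "holomorphic_curve U c \<longleftrightarrow> (\<forall>i. (\<lambda>t. c t $ i) holomorphic_on U)"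

lemma holomorphic_curve_subset: "holomorphic_curve U c \<Longrightarrow> V \<subseteq> U \<Longrightarrow> holomorphic_curve V c"
  by (auto simp: holomorphic_curve_def intro: holomorphic_on_subset)

lemma holomorphic_curve_cong:
  "(\<And>t. t \<in> U \<Longrightarrow> c t = d t) \<Longrightarrow> holomorphic_curve U c \<longleftrightarrow> holomorphic_curve U d"
  by (simp add: holomorphic_curve_def cong: holomorphic_cong)

lemma holomorphic_curve_const [holomorphic_intros]: "holomorphic_curve U (\<lambda>t. v)"
  by (simp add: holomorphic_curve_def)

lemma holomorphic_curve_add [holomorphic_intros]:
  "holomorphic_curve U c \<Longrightarrow> holomorphic_curve U d \<Longrightarrow> holomorphic_curve U (\<lambda>t. c t + d t)"
  by (simp add: holomorphic_curve_def holomorphic_on_add)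

lemma holomorphic_curve_scale [holomorphic_intros]:
  "\<phi> holomorphic_on U \<Longrightarrow> holomorphic_curve U c \<Longrightarrow> holomorphic_curve U (\<lambda>t. \<phi> t *s c t)"
  by (simp add: holomorphic_curve_def holomorphic_on_mult)

lemma holomorphic_curve_imp_continuous_on: "holomorphic_curve U c \<Longrightarrow> continuous_on U c"
  using continuous_on_vec_lambda [of U "\<lambda>i t. c t $ i"]
  by (simp add: holomorphic_curve_def holomorphic_on_imp_continuous_on)

definition curve_holomorphic_on ::
    "(complex^'n::finite \<Rightarrow> complex^'m::finite) \<Rightarrow> (complex^'n) set \<Rightarrow> bool"
    (infixl \<open>curve'_holomorphic'_on\<close> 50) where
  "F curve_holomorphic_on S \<longleftrightarrow>
    (\<forall>U c. open U \<longrightarrow> holomorphic_curve U c \<longrightarrow> c ` U \<subseteq> S \<longrightarrow> holomorphic_curve U (\<lambda>t. F (c t)))"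

lemma curve_holomorphic_onD:
  assumes "F curve_holomorphic_on S" "open U" "holomorphic_curve U c" "\<And>t. t \<in> U \<Longrightarrow> c t \<in> S"
  shows "holomorphic_curve U (\<lambda>t. F (c t))"
  using assms unfolding curve_holomorphic_on_def by blast

lemma curve_holomorphic_on_subset:
  "F curve_holomorphic_on S \<Longrightarrow> T \<subseteq> S \<Longrightarrow> F curve_holomorphic_on T"
  unfolding curve_holomorphic_on_def by blast

lemma curve_holomorphic_on_cong:
  "(\<And>z. z \<in> S \<Longrightarrow> F z = G z) \<Longrightarrow> F curve_holomorphic_on S \<longleftrightarrow> G curve_holomorphic_on S"
  unfolding curve_holomorphic_on_def
  by (intro all_cong1 imp_cong refl holomorphic_curve_cong) blast

lemma curve_holomorphic_on_ident: "(\<lambda>z. z) curve_holomorphic_on S"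
  by (simp add: curve_holomorphic_on_def)

lemma curve_holomorphic_on_scale:
  "F curve_holomorphic_on S \<Longrightarrow> (\<lambda>z. t *s F z) curve_holomorphic_on S"
  by (simp add: curve_holomorphic_on_def holomorphic_curve_scale)

lemma curve_holomorphic_on_compose:
  assumes "F curve_holomorphic_on S" "G curve_holomorphic_on T" "F ` S \<subseteq> T"
  shows "(\<lambda>z. G (F z)) curve_holomorphic_on S"
  unfolding curve_holomorphic_on_def
proof (intro allI impI)
  fix U c assume U: "open U" "holomorphic_curve U c" "c ` U \<subseteq> S"
  then have "holomorphic_curve U (\<lambda>t. F (c t))"
    by (intro curve_holomorphic_onD [OF assms(1)]) auto
  then show "holomorphic_curve U (\<lambda>t. G (F (c t)))"
    using U(1,3) assms(3) by (intro curve_holomorphic_onD [OF assms(2)]) auto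
qed

lemma curve_holomorphic_on_Union:
  assumes "\<And>S. S \<in> \<S> \<Longrightarrow> open S" "\<And>S. S \<in> \<S> \<Longrightarrow> F curve_holomorphic_on S"
  shows "F curve_holomorphic_on \<Union> \<S>"
  unfolding curve_holomorphic_on_def
proof (intro allI impI)
  fix U c assume U: "open U" "holomorphic_curve U c" "c ` U \<subseteq> \<Union> \<S>"
  show "holomorphic_curve U (\<lambda>t. F (c t))"
    unfolding holomorphic_curve_def holomorphic_on_open [OF U(1)]
  proof (intro allI ballI)
    fix i t assume "t \<in> U"
    then obtain S where S: "S \<in> \<S>" "c t \<in> S"
      using U(3) by blast
    define V where "V = U \<inter> c -` S"
    have V: "open V" "t \<in> V"
      unfolding V_def using \<open>t \<in> U\<close> S
      by (auto intro: continuous_open_preimage U(1) assms(1)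
          holomorphic_curve_imp_continuous_on [OF U(2)])
    have "holomorphic_curve V (\<lambda>t. F (c t))"
      using V(1) by (intro curve_holomorphic_onD [OF assms(2) [OF S(1)]]
          holomorphic_curve_subset [OF U(2)]) (auto simp: V_def)
    then show "\<exists>f'. ((\<lambda>t. F (c t) $ i) has_field_derivative f') (at t)"
      using V by (auto simp: holomorphic_curve_def holomorphic_on_open)
  qed
qed

lemma scaleR_eq_scale: "r *\<^sub>R z = complex_of_real r *s (z :: complex^'n::finite)"
  unfolding vec_eq_iff vector_scaleR_component vector_smult_component
  by (simp add: scaleR_conv_of_real)

lemma connected_subset_open_obtains_open_connected:
  fixes C S :: "'a::real_normed_vector set"
  assumes "connected C" "C \<subseteq> S" "open S"
  obtains U where "open U" "connected U" "C \<subseteq> U" "U \<subseteq> S"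
proof (cases "C = {}")
  case False
  then obtain x where "x \<in> C"
    by blast
  show ?thesis
  proof
    show "open (connected_component_set S x)"
      using \<open>open S\<close> by (rule open_connected_component)
    show "C \<subseteq> connected_component_set S x"
      using \<open>x \<in> C\<close> assms(1,2) by (rule connected_component_maximal)
  qed (auto simp: connected_component_subset)
qed (use that [of "{}"] in simp)

lemma curve_holomorphic_on_eq_along_segment:
  assumes F: "F curve_holomorphic_on S" and G: "G curve_holomorphic_on S"
    and S: "open S" "closed_segment p z \<subseteq> S"
    and A: "open A" "A \<subseteq> S" "p \<in> A" and eq_on_A: "\<And>x. x \<in> A \<Longrightarrow> F x = G x"
  shows "F z = G z"
proof -
  define c where "c t = p + t *s (z - p)" for t
  have curve: "holomorphic_curve T c" for T
    unfolding c_def by (intro holomorphic_intros)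
  have cont: "continuous_on UNIV c"
    by (intro holomorphic_curve_imp_continuous_on curve)
  have c_of_real: "c (of_real s) = (1 - s) *\<^sub>R p + s *\<^sub>R z" for s
    by (simp add: c_def scaleR_eq_scale vec_eq_iff algebra_simps)
  obtain U where U: "open U" "connected U" "of_real ` {0..1} \<subseteq> U" "U \<subseteq> c -` S"
  proof (rule connected_subset_open_obtains_open_connected)
    show "connected (of_real ` {0..1} :: complex set)"
      by (intro connected_continuous_image continuous_intros) auto
    show "of_real ` {0..1} \<subseteq> c -` S"
      using S(2) by (force simp: c_of_real closed_segment_def)
    show "open (c -` S)"
      using S(1) cont by (rule open_vimage)
  qed
  then have endpoints: "0 \<in> U" "1 \<in> U"
    by (auto simp: image_subset_iff dest: bspec [of _ _ 0] bspec [of _ _ 1])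
  have "F (c 1) $ j = G (c 1) $ j" for j
  proof (rule analytic_continuation_open [of "U \<inter> c -` A" U "\<lambda>t. F (c t) $ j" "\<lambda>t. G (c t) $ j"])
    show "open (U \<inter> c -` A)"
      using U(1) open_vimage [OF A(1) cont] by blast
    show "U \<inter> c -` A \<noteq> {}"
      using endpoints(1) A(3) by (auto simp: c_def)
    show "(\<lambda>t. F (c t) $ j) holomorphic_on U" "(\<lambda>t. G (c t) $ j) holomorphic_on U"
      using curve_holomorphic_onD [OF F U(1) curve] curve_holomorphic_onD [OF G U(1) curve] U(4)
      by (auto simp: holomorphic_curve_def)
  qed (use U endpoints eq_on_A in auto)
  then show ?thesis
    by (simp add: vec_eq_iff c_def)
qed

lemma curve_holomorphic_on_UNIV_eq:
  assumes "F curve_holomorphic_on UNIV" "G curve_holomorphic_on UNIV"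
    and "open A" "A \<noteq> {}" "\<And>z. z \<in> A \<Longrightarrow> F z = G z"
  shows "F = G"
proof
  obtain p where "p \<in> A"
    using assms(4) by blast
  with assms show "F z = G z" for z
    by (auto intro: curve_holomorphic_on_eq_along_segment [of F UNIV G p z A])
qed

lemma curve_holomorphic_left_inverse_on_UNIV:
  assumes F: "F curve_holomorphic_on UNIV" and G: "G curve_holomorphic_on UNIV"
    and A: "open A" "A \<noteq> {}" and left_inverse: "\<And>z. z \<in> A \<Longrightarrow> G (F z) = z"
  shows "G (F z) = z"
proof -
  have "(\<lambda>z. G (F z)) curve_holomorphic_on UNIV"
    by (rule curve_holomorphic_on_compose [OF F G]) simp
  then have "(\<lambda>z. G (F z)) = (\<lambda>z. z)"
    using curve_holomorphic_on_ident A left_inverse by (rule curve_holomorphic_on_UNIV_eq)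
  then show ?thesis
    by (rule fun_cong)
qed

lemma holo_on_imp_continuous_on: "holo_on S f \<Longrightarrow> continuous_on S f"
  unfolding holo_on_def
  by (meson continuous_at_imp_continuous_on has_derivative_continuous)

lemma holo_on_imp_curve_holomorphic_on:
  assumes "holo_on S f"
  shows "f curve_holomorphic_on S"
  unfolding curve_holomorphic_on_def
proof (intro allI impI)
  fix U c assume U: "open U" "holomorphic_curve U c" "c ` U \<subseteq> S"
  show "holomorphic_curve U (\<lambda>t. f (c t))"
    unfolding holomorphic_curve_def holomorphic_on_open [OF U(1)]
  proof (intro allI ballI)
    fix j t assume t: "t \<in> U"
    then obtain L where L: "(f has_derivative L) (at (c t))" "\<And>a v. L (a *s v) = a *s L v"
      using assms U(3) unfolding holo_on_def by blast
    define d where "d = (\<chi> i. deriv (\<lambda>t. c t $ i) t)"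
    have "((\<lambda>t. c t $ i) has_field_derivative d $ i) (at t)" for i
      using U(1,2) t unfolding holomorphic_curve_def d_def by (auto intro: holomorphic_derivI)
    then have "((\<lambda>t. c t $ i) has_derivative (\<lambda>s. (s *s d) $ i)) (at t)" for i
      by (simp add: has_field_derivative_def mult_commute_abs)
    then have "(c has_derivative (\<lambda>s. s *s d)) (at t)"
      by (subst has_derivative_componentwise_within)
        (auto simp: Basis_vec_def inner_axis intro: has_derivative_inner_left)
    then have "((\<lambda>t. f (c t)) has_derivative (\<lambda>s. L (s *s d))) (at t)"
      using L(1) by (rule has_derivative_compose)
    then have "((\<lambda>t. f (c t) $ j) has_derivative (\<lambda>s. L (s *s d) $ j)) (at t)"
      by (rule bounded_linear.has_derivative [OF bounded_linear_vec_nth])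
    then have "((\<lambda>t. f (c t) $ j) has_field_derivative L d $ j) (at t)"
      unfolding has_field_derivative_def by (simp add: L(2) mult.commute [of _ "L d $ j"])
    then show "\<exists>f'. ((\<lambda>t. f (c t) $ j) has_field_derivative f') (at t)"
      by blast
  qed
qed

section \<open>The indefinite form and its positive cone\<close>

definition herm_form :: "'n::finite \<Rightarrow> complex^'n \<Rightarrow> real" where
  "herm_form e0 z = (\<Sum>i\<in>UNIV - {e0}. (cmod (z $ i))\<^sup>2) - (cmod (z $ e0))\<^sup>2"

lemma Dn1_eq: "Dn1 e0 = {z. 0 < herm_form e0 z}"
  by (auto simp: Dn1_def herm_form_def)

lemma continuous_on_herm_form [continuous_intros]:
  "continuous_on S f \<Longrightarrow> continuous_on S (\<lambda>x. herm_form e0 (f x))"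
  unfolding herm_form_def by (intro continuous_intros)

lemma herm_form_eq_norm: "herm_form e0 z = (norm z)\<^sup>2 - 2 * (cmod (z $ e0))\<^sup>2"
proof -
  have "(norm z)\<^sup>2 = (\<Sum>i\<in>UNIV. (cmod (z $ i))\<^sup>2)"
    by (simp add: power2_norm_eq_inner inner_vec_def)
  also have "\<dots> = (cmod (z $ e0))\<^sup>2 + (\<Sum>i\<in>UNIV - {e0}. (cmod (z $ i))\<^sup>2)"
    by (rule sum.remove) auto
  finally show ?thesis
    by (simp add: herm_form_def)
qed

lemma norm_axis: "norm (axis i c :: 'a::real_inner^'n::finite) = norm c"
  by (simp add: norm_eq_sqrt_inner inner_axis_axis)

lemma norm_axis_add_axis:
  fixes a b :: "'a::real_inner"
  assumes "i \<noteq> j"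
  shows "(norm (axis i a + axis j b :: 'a^'n::finite))\<^sup>2 = (norm a)\<^sup>2 + (norm b)\<^sup>2"
proof -
  have "orthogonal (axis i a :: 'a^'n) (axis j b)"
    using assms by (simp add: orthogonal_def inner_axis_axis)
  then show ?thesis
    by (simp add: norm_add_Pythagorean norm_axis)
qed

lemma herm_form_axis_self [simp]: "herm_form e0 (axis e0 c) = - (cmod c)\<^sup>2"
  by (simp add: herm_form_def axis_def)

lemma open_Dn1: "open (Dn1 e0)"
  unfolding Dn1_eq by (intro open_Collect_less continuous_intros)

lemma mem_Dn1_mono:
  assumes "z \<in> Dn1 e0" "cmod (x $ e0) \<le> cmod (z $ e0)"
    and "\<And>i. i \<noteq> e0 \<Longrightarrow> cmod (z $ i) \<le> cmod (x $ i)"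
  shows "x \<in> Dn1 e0"
proof -
  have "(cmod (x $ e0))\<^sup>2 \<le> (cmod (z $ e0))\<^sup>2"
    using assms(2) by (intro power_mono) auto
  moreover have "(\<Sum>i\<in>UNIV - {e0}. (cmod (z $ i))\<^sup>2) \<le> (\<Sum>i\<in>UNIV - {e0}. (cmod (x $ i))\<^sup>2)"
    using assms(3) by (intro sum_mono power_mono) auto
  ultimately show ?thesis
    using assms(1) unfolding Dn1_def mem_Collect_eq by linarith
qed

lemma mem_Dn1_if_component_gt:
  assumes "i \<noteq> e0" "cmod (z $ e0) < cmod (z $ i)"
  shows "z \<in> Dn1 e0"
proof -
  have "(cmod (z $ e0))\<^sup>2 < (cmod (z $ i))\<^sup>2"
    using assms by (intro power_strict_mono) auto
  also have "\<dots> \<le> (\<Sum>i\<in>UNIV - {e0}. (cmod (z $ i))\<^sup>2)"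
    using assms by (intro member_le_sum) auto
  finally show ?thesis
    by (simp add: Dn1_def)
qed

lemma axis_mem_Dn1: "i \<noteq> e0 \<Longrightarrow> axis i 1 \<in> Dn1 e0"
  by (intro mem_Dn1_if_component_gt [of i]) (auto simp: axis_def)

lemma scale_mem_Dn1_iff: "t *s z \<in> Dn1 e0 \<longleftrightarrow> t \<noteq> 0 \<and> z \<in> Dn1 e0"
proof -
  have "herm_form e0 (t *s z) = (cmod t)\<^sup>2 * herm_form e0 z"
    by (simp add: herm_form_def norm_mult power_mult_distrib sum_distrib_left algebra_simps)
  then show ?thesis
    by (auto simp: Dn1_eq zero_less_mult_iff)
qed

lemma norm_component_le_if_not_mem_Dn1:
  assumes "z \<notin> Dn1 e0"
  shows "cmod (z $ i) \<le> cmod (z $ e0)"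
  using assms mem_Dn1_if_component_gt [of i e0 z] by (cases "i = e0") force+

section \<open>Hartogs extension from Dn1\<close>

definition hartogs_integral ::
    "'n::finite \<Rightarrow> real \<Rightarrow> (complex^'n \<Rightarrow> complex^'m::finite) \<Rightarrow> complex^'n \<Rightarrow> complex^'m" where
  "hartogs_integral e1 R F z = (\<chi> j. contour_integral (circlepath 0 (2 * R))
     (\<lambda>w. F (z + w *s axis e1 1) $ j / w) / (2 * of_real pi * \<i>))"

lemma circle_mem_Dn1:
  assumes "e1 \<noteq> e0" "z \<in> ball 0 R" "w \<in> path_image (circlepath 0 (2 * R))"
  shows "z + w *s axis e1 1 \<in> Dn1 e0"
proof (rule mem_Dn1_if_component_gt [OF assms(1)])
  have R: "norm z < R" "cmod w = 2 * R"
    using assms order_le_less_trans [OF norm_ge_zero, of z R] by auto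
  have "cmod ((z + w *s axis e1 1) $ e0) \<le> norm z"
    using assms(1) Finite_Cartesian_Product.norm_nth_le [of z e0] by (simp add: axis_def)
  also have "\<dots> < cmod w - cmod (z $ e1)"
    using R Finite_Cartesian_Product.norm_nth_le [of z e1] by simp
  also have "\<dots> \<le> cmod ((z + w *s axis e1 1) $ e1)"
    using norm_diff_ineq [of w "z $ e1"] by (simp add: add.commute axis_def)
  finally show "cmod ((z + w *s axis e1 1) $ e0) < cmod ((z + w *s axis e1 1) $ e1)" .
qed

text \<open>The segment from z to p shrinks the component e0 to 0 and, if z $ e2 vanishes, makes it
  nonzero; no component other than e0 decreases in modulus.\<close>

lemma segment_in_Dn1_to_component_gt:
  fixes z :: "complex^'n::finite"
  assumes e2: "e2 \<noteq> e0" and z: "z \<in> Dn1 e0" "z \<in> ball 0 R"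
  obtains p where "closed_segment p z \<subseteq> Dn1 e0 \<inter> ball 0 R" "cmod (p $ e0) < cmod (p $ e2)"
proof -
  define \<delta> where "\<delta> = (if z $ e2 = 0 then of_real ((R - norm z) / 2) else 0 :: complex)"
  define y where "y = (\<chi> i. if i = e0 then 0 else z $ i)"
  define p where "p = y + axis e2 \<delta>"
  have "norm p < R"
  proof -
    have "norm y \<le> norm z"
      unfolding y_def by (intro norm_le_componentwise_cart) auto
    moreover have "cmod \<delta> < R - norm z"
      unfolding \<delta>_def if_distrib [of cmod] norm_of_real using z(2) by simp
    ultimately show ?thesis
      using norm_triangle_ineq [of y "axis e2 \<delta>"] by (simp add: p_def norm_axis)
  qed
  then have "closed_segment z p \<subseteq> ball 0 R"
    using z(2) by (intro closed_segment_subset) auto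
  have p: "p $ e0 = 0" "p $ e2 \<noteq> 0" "\<And>i. i \<noteq> e0 \<Longrightarrow> z $ i \<noteq> 0 \<Longrightarrow> p $ i = z $ i"
    using e2 z(2) by (auto simp: p_def y_def \<delta>_def axis_def)
  have "x \<in> Dn1 e0" if "x \<in> closed_segment z p" for x
  proof (rule mem_Dn1_mono [OF z(1)])
    obtain s where s: "0 \<le> s" "s \<le> 1" "\<And>i. x $ i = (1 - s) *\<^sub>R z $ i + s *\<^sub>R p $ i"
      using \<open>x \<in> closed_segment z p\<close> by (auto simp: closed_segment_def)
    show "cmod (x $ e0) \<le> cmod (z $ e0)"
      using s(1,2) by (simp add: s(3) p(1) mult_left_le_one_le)
    show "cmod (z $ i) \<le> cmod (x $ i)" if "i \<noteq> e0" for i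
      using p(3) [OF that] by (cases "z $ i = 0") (auto simp: s(3) algebra_simps)
  qed
  then have "closed_segment p z \<subseteq> Dn1 e0 \<inter> ball 0 R"
    unfolding closed_segment_commute [of p] using \<open>closed_segment z p \<subseteq> ball 0 R\<close> by blast
  then show ?thesis
    using p that by simp
qed

context
  fixes e0 e1 e2 :: "'n::finite" and F :: "complex^'n \<Rightarrow> complex^'m::finite"
  assumes indices: "e1 \<noteq> e0" "e2 \<noteq> e0" "e2 \<noteq> e1"
    and hol: "F curve_holomorphic_on Dn1 e0" and cont: "continuous_on (Dn1 e0) F"
begin

lemma hartogs_integral_curve_holomorphic_on:
  "hartogs_integral e1 R F curve_holomorphic_on ball 0 R"
  unfolding curve_holomorphic_on_def
proof (intro allI impI)
  fix U c assume U: "open U" "holomorphic_curve U c" "c ` U \<subseteq> (ball 0 R :: (complex^'n) set)"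
  let ?C = "circlepath 0 (2 * R)"
  have mem: "c t + w *s axis e1 1 \<in> Dn1 e0" and nonzero: "w \<noteq> 0"
    if "t \<in> U" "w \<in> path_image ?C" for t w
    using that U(3) circle_mem_Dn1 [OF indices(1), of "c t" R w]
      order_le_less_trans [OF norm_ge_zero, of "c t" R] by auto
  have "(\<lambda>t. contour_integral ?C (\<lambda>w. F (c t + w *s axis e1 1) $ j / w)) holomorphic_on U" for j
  proof (rule holomorphic_on_contour_integral_param [OF U(1)])
    have "continuous_on (U \<times> path_image ?C) (\<lambda>x. c (fst x))"
      by (rule continuous_on_compose2 [OF holomorphic_curve_imp_continuous_on [OF U(2)]])
        (auto intro!: continuous_intros)
    then have "continuous_on (U \<times> path_image ?C) (\<lambda>x. c (fst x) + snd x *s axis e1 1)"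
      unfolding vector_scalar_mult_def by (intro continuous_intros continuous_on_vec_lambda)
    then have "continuous_on (U \<times> path_image ?C) (\<lambda>x. F (c (fst x) + snd x *s axis e1 1))"
      by (rule continuous_on_compose2 [OF cont]) (use mem in force)
    then show "continuous_on (U \<times> path_image ?C) (\<lambda>(t, w). F (c t + w *s axis e1 1) $ j / w)"
      unfolding split_def using nonzero by (intro continuous_intros) auto
  next
    fix w assume w: "w \<in> path_image ?C"
    have "holomorphic_curve U (\<lambda>t. F (c t + w *s axis e1 1))"
      using mem w U by (intro curve_holomorphic_onD [OF hol] holomorphic_intros) auto
    then show "(\<lambda>t. F (c t + w *s axis e1 1) $ j / w) holomorphic_on U"
      unfolding divide_inverse holomorphic_curve_def by (intro holomorphic_intros) auto
  next
    show "continuous_on {0..1} (\<lambda>s. vector_derivative ?C (at s))"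
      unfolding vector_derivative_circlepath by (intro continuous_intros)
  qed auto
  then show "holomorphic_curve U (\<lambda>t. hartogs_integral e1 R F (c t))"
    unfolding holomorphic_curve_def hartogs_integral_def by (auto intro!: holomorphic_intros)
qed

lemma hartogs_integral_eq_if_component_gt:
  assumes "0 < R" and gt: "cmod (z $ e0) < cmod (z $ e2)"
  shows "hartogs_integral e1 R F z = F z"
proof -
  have "z + w *s axis e1 1 \<in> Dn1 e0" for w
    using indices gt by (intro mem_Dn1_if_component_gt [of e2]) (auto simp: axis_def)
  then have "holomorphic_curve UNIV (\<lambda>w. F (z + w *s axis e1 1))"
    by (intro curve_holomorphic_onD [OF hol] holomorphic_intros) auto
  then have "((\<lambda>w. F (z + w *s axis e1 1) $ j / (w - 0)) has_contour_integral
      (2 * of_real pi * \<i> * F (z + 0 *s axis e1 1) $ j)) (circlepath 0 (2 * R))" for j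
    using \<open>0 < R\<close> by (intro Cauchy_integral_circlepath_simple)
      (auto simp: holomorphic_curve_def intro: holomorphic_on_subset)
  from contour_integral_unique [OF this] show ?thesis
    by (simp add: hartogs_integral_def vec_eq_iff)
qed

lemma hartogs_integral_eq:
  assumes z: "z \<in> Dn1 e0" "z \<in> ball 0 R"
  shows "hartogs_integral e1 R F z = F z"
proof -
  obtain p where seg: "closed_segment p z \<subseteq> Dn1 e0 \<inter> ball 0 R"
    and p_gt: "cmod (p $ e0) < cmod (p $ e2)"
    using segment_in_Dn1_to_component_gt [OF indices(2) z] .
  have R_pos: "0 < R"
    using z(2) by (auto intro: order_le_less_trans [OF norm_ge_zero])
  define A where "A = {x. cmod (x $ e0) < cmod (x $ e2)} \<inter> ball 0 R"
  show ?thesis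
  proof (rule curve_holomorphic_on_eq_along_segment [OF _ _ _ seg])
    show "open A"
      unfolding A_def by (intro open_Int open_Collect_less continuous_intros open_ball)
    show "p \<in> A"
      using p_gt seg by (auto simp: A_def)
    show "A \<subseteq> Dn1 e0 \<inter> ball 0 R"
      using indices by (auto simp: A_def intro: mem_Dn1_if_component_gt)
    show "hartogs_integral e1 R F x = F x" if "x \<in> A" for x
      using that R_pos by (intro hartogs_integral_eq_if_component_gt) (auto simp: A_def)
  qed (auto intro: curve_holomorphic_on_subset [OF hartogs_integral_curve_holomorphic_on]
      curve_holomorphic_on_subset [OF hol] open_Dn1)
qed

lemma hartogs_integral_radius_mono:
  assumes "R \<le> R'" and z: "z \<in> ball 0 R"
  shows "hartogs_integral e1 R F z = hartogs_integral e1 R' F z"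
proof -
  define p :: "complex^'n" where "p = axis e1 (of_real (R / 2))"
  have R_pos: "0 < R"
    using z by (auto intro: order_le_less_trans [OF norm_ge_zero])
  have "p \<in> Dn1 e0"
    using R_pos indices(1) by (intro mem_Dn1_if_component_gt [of e1]) (auto simp: p_def axis_def)
  moreover have "p \<in> ball 0 R"
    unfolding p_def mem_ball_0 norm_axis norm_of_real using R_pos by simp
  ultimately have p: "p \<in> Dn1 e0 \<inter> ball 0 R"
    by blast
  have sub: "ball 0 R \<subseteq> (ball 0 R' :: (complex^'n) set)"
    using assms(1) by (rule subset_ball)
  show ?thesis
  proof (rule curve_holomorphic_on_eq_along_segment [OF _ _ _ _ _ _ p])
    show "hartogs_integral e1 R F curve_holomorphic_on ball 0 R"
      "hartogs_integral e1 R' F curve_holomorphic_on ball 0 R"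
      by (rule hartogs_integral_curve_holomorphic_on
          curve_holomorphic_on_subset [OF hartogs_integral_curve_holomorphic_on sub])+
    show "closed_segment p z \<subseteq> ball 0 R"
      using p z by (intro closed_segment_subset) auto
    show "hartogs_integral e1 R F x = hartogs_integral e1 R' F x" if "x \<in> Dn1 e0 \<inter> ball 0 R" for x
      using that sub by (auto simp: hartogs_integral_eq)
  qed (auto simp: open_Dn1)
qed

lemma Hartogs_extension_from_Dn1:
  obtains H where "H curve_holomorphic_on UNIV" "\<And>z. z \<in> Dn1 e0 \<Longrightarrow> H z = F z"
proof -
  define H where "H z = hartogs_integral e1 (1 + norm z) F z" for z
  have H_eq: "H z = hartogs_integral e1 R F z" if "z \<in> ball 0 R" for z R
  proof (cases "R \<le> 1 + norm z")
    case True
    then show ?thesis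
      unfolding H_def using that by (rule hartogs_integral_radius_mono [symmetric])
  next
    case False
    then show ?thesis
      unfolding H_def by (intro hartogs_integral_radius_mono) auto
  qed
  have "H curve_holomorphic_on ball 0 R \<longleftrightarrow>
      hartogs_integral e1 R F curve_holomorphic_on ball 0 R" for R
    using H_eq by (rule curve_holomorphic_on_cong)
  then have "H curve_holomorphic_on ball 0 R" for R
    using hartogs_integral_curve_holomorphic_on by blast
  moreover have "\<Union> (range (ball 0)) = (UNIV :: (complex^'n) set)"
    by (auto intro: gt_ex)
  ultimately have "H curve_holomorphic_on UNIV"
    using curve_holomorphic_on_Union [of "range (ball 0)" H] by auto
  moreover have "H z = F z" if "z \<in> Dn1 e0" for z
    unfolding H_def using that by (intro hartogs_integral_eq) auto
  ultimately show ?thesis ..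
qed

end

section \<open>Automorphisms of Dn1 are linear\<close>

context
  fixes e0 e1 :: "'n::finite" and F :: "complex^'n \<Rightarrow> complex^'n"
  assumes e1: "e1 \<noteq> e0" and hol: "F curve_holomorphic_on UNIV" and bij: "bij F"
    and F_mem_iff: "\<And>z. F z \<in> Dn1 e0 \<longleftrightarrow> z \<in> Dn1 e0"
begin

lemma affine_on_line_in_cone:
  assumes z: "z \<notin> Dn1 e0" "z \<noteq> 0"
  obtains a b u where "\<And>t. F (t *s z) = (a + t * b) *s u" "b \<noteq> 0"
proof -
  define \<psi> where "\<psi> t = F (t *s z) $ e0" for t
  have "holomorphic_curve UNIV (\<lambda>t. F (t *s z))"
    by (intro curve_holomorphic_onD [OF hol] holomorphic_intros) auto
  then have hol_line: "(\<lambda>t. F (t *s z) $ j) holomorphic_on UNIV" for j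
    by (simp add: holomorphic_curve_def)
  have "\<exists>c. \<forall>t. F (t *s z) $ j = c * \<psi> t" for j
  proof (rule entire_norm_le_imp_proportional)
    show "cmod (F (t *s z) $ j) \<le> cmod (\<psi> t)" for t
      unfolding \<psi>_def using z(1)
      by (intro norm_component_le_if_not_mem_Dn1) (simp add: F_mem_iff scale_mem_Dn1_iff)
  qed (auto simp: \<psi>_def hol_line)
  then obtain c where "\<And>j t. F (t *s z) $ j = c j * \<psi> t"
    by metis
  then have F_line: "F (t *s z) = \<psi> t *s (\<chi> j. c j)" for t
    by (simp add: vec_eq_iff)
  have "inj \<psi>"
  proof (rule injI)
    fix s t assume "\<psi> s = \<psi> t"
    then show "s = t"
      using injD [OF bij_is_inj [OF bij], of "s *s z" "t *s z"] z(2) by (simp add: F_line)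
  qed
  moreover have "\<psi> holomorphic_on UNIV"
    unfolding \<psi>_def by (rule hol_line)
  ultimately obtain a b where "\<And>t. \<psi> t = a + t * b" "b \<noteq> 0"
    using injective_entire_imp_affine by blast
  then show ?thesis
    using that F_line by simp
qed

lemma cone_preserving_fixes_0: "F 0 = 0"
proof -
  obtain p where F_p: "F p = 0"
    using bij by (metis bij_pointE)
  have p_line: "\<exists>t. p = t *s z" if "z \<notin> Dn1 e0" "z \<noteq> 0" for z
  proof -
    obtain a b u where F_line: "\<And>t. F (t *s z) = (a + t * b) *s u" and "b \<noteq> 0"
      using affine_on_line_in_cone [OF \<open>z \<notin> Dn1 e0\<close> \<open>z \<noteq> 0\<close>] by metis
    then have "F ((- a / b) *s z) = F p"
      unfolding F_line F_p using \<open>b \<noteq> 0\<close> by simp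
    then show ?thesis
      using bij_is_inj [OF bij] by (metis injD)
  qed
  have "axis e0 1 \<notin> Dn1 e0"
    by (simp add: Dn1_eq)
  moreover have "axis e0 1 + axis e1 1 \<notin> Dn1 e0"
    using e1 by (simp add: Dn1_eq herm_form_eq_norm norm_axis_add_axis) (simp add: axis_def)
  moreover have "axis e0 1 \<noteq> (0 :: complex^'n)" "axis e0 1 + axis e1 1 \<noteq> (0 :: complex^'n)"
    using e1 by (auto simp: vec_eq_iff axis_def dest: spec [of _ e0])
  ultimately obtain s t where p_eq: "p = s *s axis e0 1" "p = t *s (axis e0 1 + axis e1 1)"
    using p_line by metis
  have "t = 0"
    using e1 arg_cong [OF p_eq(1), of "\<lambda>x. x $ e1"] arg_cong [OF p_eq(2), of "\<lambda>x. x $ e1"]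
    by (simp add: axis_def)
  then show ?thesis
    using F_p p_eq(2) by simp
qed

lemma cone_preserving_homogeneous: "F (t *s z) = t *s F z"
proof -
  have on_cone: "F (t *s x) = t *s F x" if x: "x \<notin> Dn1 e0" for x
  proof (cases "x = 0")
    case False
    obtain a b u where F_line: "\<And>t. F (t *s x) = (a + t * b) *s u"
      using affine_on_line_in_cone [OF x False] by metis
    have "a *s u = 0"
      using F_line [of 0] cone_preserving_fixes_0 by simp
    then show ?thesis
      using F_line [of t] F_line [of 1] by (auto simp: vec_eq_iff algebra_simps)
  qed (simp add: cone_preserving_fixes_0)
  have "(\<lambda>z. F (t *s z)) = (\<lambda>z. t *s F z)"
  proof (rule curve_holomorphic_on_UNIV_eq)
    show "(\<lambda>z. F (t *s z)) curve_holomorphic_on UNIV"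
      by (intro curve_holomorphic_on_compose [OF curve_holomorphic_on_scale hol]
          curve_holomorphic_on_ident) simp
    show "(\<lambda>z. t *s F z) curve_holomorphic_on UNIV"
      by (intro curve_holomorphic_on_scale hol)
    show "open {z. herm_form e0 z < 0}"
      by (intro open_Collect_less continuous_intros)
    have "herm_form e0 (axis e0 1) < 0"
      by simp
    then show "{z. herm_form e0 z < 0} \<noteq> {}"
      by blast
    show "F (t *s z) = t *s F z" if "z \<in> {z. herm_form e0 z < 0}" for z
      using on_cone [of z] that by (simp add: Dn1_eq)
  qed
  then show ?thesis
    by (rule fun_cong)
qed

text \<open>By homogeneity F (z + s v) - s F v = s (F (v + z / s) - F v), which converges as s tends to
  infinity; hence it is constant by Liouville, and its value at s = 0 is F z.\<close>

lemma cone_preserving_additive: "F (z + v) = F z + F v"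
proof -
  have "F (z + v) $ j - F v $ j = F z $ j" for j
  proof -
    define p where "p s = F (z + s *s v) $ j - s * F v $ j" for s
    define r where "r s = F (v + s *s z) $ j" for s
    have "holomorphic_curve UNIV (\<lambda>s. F (z + s *s v))"
      "holomorphic_curve UNIV (\<lambda>s. F (v + s *s z))"
      by (intro curve_holomorphic_onD [OF hol] holomorphic_intros; simp)+
    then have hol_p: "p holomorphic_on UNIV" and hol_r: "r holomorphic_on UNIV"
      unfolding p_def r_def holomorphic_curve_def by (auto intro!: holomorphic_intros)
    have "(p \<circ> inverse) s = (r s - r 0) / s" if "s \<noteq> 0" for s
    proof -
      have "z + inverse s *s v = inverse s *s (v + s *s z)"
        using that by (simp add: vec_eq_iff algebra_simps)
      then have "F (z + inverse s *s v) = inverse s *s F (v + s *s z)"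
        by (simp only: cone_preserving_homogeneous)
      then show ?thesis
        by (simp add: p_def r_def divide_inverse algebra_simps)
    qed
    moreover have "((\<lambda>s. (r s - r 0) / s) \<longlongrightarrow> deriv r 0) (at 0)"
      using holomorphic_derivI [OF hol_r open_UNIV, of 0 UNIV]
      by (simp add: has_field_derivative_iff)
    ultimately have "((p \<circ> inverse) \<longlongrightarrow> deriv r 0) (at 0)"
      by (subst Lim_cong_within [OF refl refl refl]) auto
    then have "p s = deriv r 0" for s
      using Liouville_weak [OF hol_p] by (simp add: lim_at_infinity_0)
    then have "p 1 = p 0"
      by simp
    then show ?thesis
      by (simp add: p_def)
  qed
  then show ?thesis
    by (simp add: vec_eq_iff algebra_simps)
qed

lemma cone_preserving_linear: "Vector_Spaces.linear (*s) (*s) F"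
  by unfold_locales (simp_all add: cone_preserving_additive cone_preserving_homogeneous)

end

lemma Aut_homeomorphism:
  assumes "f \<in> Aut S"
  shows "homeomorphism S S f (aut_inv S f)"
proof (rule homeomorphismI)
  have bij: "bij_betw f S S"
    using assms by (simp add: Aut_def)
  show "continuous_on S f" "continuous_on S (aut_inv S f)"
    using assms by (auto simp: Aut_def intro: holo_on_imp_continuous_on)
  show "f ` S \<subseteq> S" "aut_inv S f ` S \<subseteq> S"
    using bij_betw_apply [OF bij] bij_betw_apply [OF bij_betw_inv_into [OF bij]]
    by (auto simp: aut_inv_def)
  show "aut_inv S f (f x) = x" if "x \<in> S" for x
    using that bij_betw_apply [OF bij] bij_betw_inv_into_left [OF bij] by (auto simp: aut_inv_def)
  show "f (aut_inv S f y) = y" if "y \<in> S" for y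
    using that bij_betw_inv_into_right [OF bij] by (auto simp: aut_inv_def)
qed

lemma obtain_two_other_indices:
  fixes e0 :: "'n::finite"
  assumes "CARD('n) \<ge> 3"
  obtains e1 e2 where "e1 \<noteq> e0" "e2 \<noteq> e0" "e2 \<noteq> e1"
proof -
  have "\<not> UNIV \<subseteq> {e0}"
    using assms card_mono [of "{e0}" UNIV] by fastforce
  then obtain e1 where e1: "e1 \<noteq> e0"
    by blast
  have "\<not> UNIV \<subseteq> {e0, e1}"
    using assms card_mono [of "{e0, e1}" UNIV] e1 by fastforce
  then show ?thesis
    using that e1 by blast
qed

lemma holo_on_Dn1_extends:
  fixes e0 :: "'n::finite"
  assumes "CARD('n) \<ge> 3" "holo_on (Dn1 e0) f"
  obtains F where "F curve_holomorphic_on UNIV" "\<And>z. z \<in> Dn1 e0 \<Longrightarrow> F z = f z"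
proof -
  obtain e1 e2 where indices: "e1 \<noteq> e0" "e2 \<noteq> e0" "e2 \<noteq> e1"
    using obtain_two_other_indices [OF assms(1)] .
  show ?thesis
    using that by (rule Hartogs_extension_from_Dn1 [OF indices
        holo_on_imp_curve_holomorphic_on [OF assms(2)] holo_on_imp_continuous_on [OF assms(2)]])
qed

lemma Aut_Dn1_extends_to_linear:
  fixes e0 :: "'n::finite"
  assumes card: "CARD('n) \<ge> 3" and f: "f \<in> Aut (Dn1 e0)"
  obtains F where "Vector_Spaces.linear (*s) (*s) F" "\<And>z. F z \<in> Dn1 e0 \<longleftrightarrow> z \<in> Dn1 e0"
    "\<And>z. z \<in> Dn1 e0 \<Longrightarrow> F z = f z"
proof -
  let ?D = "Dn1 e0"
  obtain e1 where e1: "e1 \<noteq> e0"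
    using obtain_two_other_indices [OF card] .
  obtain F where F: "F curve_holomorphic_on UNIV" "\<And>z. z \<in> ?D \<Longrightarrow> F z = f z"
    using holo_on_Dn1_extends [OF card, of e0 f] f by (auto simp: Aut_def)
  obtain G where G: "G curve_holomorphic_on UNIV" "\<And>z. z \<in> ?D \<Longrightarrow> G z = aut_inv ?D f z"
    using holo_on_Dn1_extends [OF card, of e0 "aut_inv ?D f"] f by (auto simp: Aut_def)
  have hom: "homeomorphism ?D ?D f (aut_inv ?D f)"
    using f by (rule Aut_homeomorphism)
  have maps: "F z \<in> ?D" "G z \<in> ?D" if "z \<in> ?D" for z
    using that imageI [OF that] homeomorphism_image1 [OF hom] homeomorphism_image2 [OF hom]
    by (metis F(2) G(2))+
  have inverse_on_Dn1: "G (F z) = z" "F (G z) = z" if "z \<in> ?D" for z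
    using that maps homeomorphism_apply1 [OF hom] homeomorphism_apply2 [OF hom] F(2) G(2) by metis+
  have "?D \<noteq> {}"
    using axis_mem_Dn1 [OF e1] by blast
  then have inverse: "G (F z) = z" "F (G z) = z" for z
    using curve_holomorphic_left_inverse_on_UNIV [OF F(1) G(1) open_Dn1]
      curve_holomorphic_left_inverse_on_UNIV [OF G(1) F(1) open_Dn1] inverse_on_Dn1
    by simp_all
  then have "bij F"
    by (intro o_bij [of G]) auto
  moreover have "F z \<in> ?D \<longleftrightarrow> z \<in> ?D" for z
    using maps inverse by metis
  ultimately show ?thesis
    using that cone_preserving_linear [OF e1 F(1)] F(2) by blast
qed

section \<open>The multiplier of the form under an automorphism\<close>

lemma quadratic_real_roots:
  fixes a b c :: real
  assumes "0 < a" "c < 0"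
  obtains r s where "r < s" "c * (r + s) = - b" "c * (r * s) = a"
proof -
  define d where "d = sqrt (b\<^sup>2 - 4 * a * c)"
  define r s where "r = (d - b) / (2 * c)" and "s = (- d - b) / (2 * c)"
  have "0 < b\<^sup>2 - 4 * a * c"
    using mult_pos_neg [OF assms] zero_le_power2 [of b] by linarith
  then have d: "0 < d" "d\<^sup>2 = b\<^sup>2 - 4 * a * c"
    unfolding d_def by simp_all
  have roots: "2 * c * r = d - b" "2 * c * s = - d - b"
    using \<open>c < 0\<close> by (simp_all add: r_def s_def)
  then have "c * (4 * (c * (r * s))) = c * (4 * a)"
    using d(2) by algebra
  moreover have "r < s"
    using d(1) \<open>c < 0\<close> by (simp add: r_def s_def divide_less_cancel)
  ultimately show ?thesis
    using that [of r s] \<open>c < 0\<close> roots by (simp add: algebra_simps)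
qed

lemma quadratic_polynomials_proportional:
  fixes a b c a' b' c' :: real
  assumes "0 < a" "c < 0"
    and pos_iff: "\<And>t. 0 < a + b * t + c * t\<^sup>2 \<longleftrightarrow> 0 < a' + b' * t + c' * t\<^sup>2"
  shows "a' * c = a * c'"
proof -
  obtain r s where "r < s" and Vieta: "c * (r + s) = - b" "c * (r * s) = a"
    using quadratic_real_roots [OF assms(1,2)] .
  define p where "p t = a' + b' * t + c' * t\<^sup>2" for t
  have factor: "a + b * t + c * t\<^sup>2 = c * ((t - r) * (t - s))" for t
    using Vieta by algebra
  have p_pos: "0 < p t \<longleftrightarrow> r < t \<and> t < s" for t
    unfolding p_def pos_iff [symmetric] factor using \<open>c < 0\<close> \<open>r < s\<close>
    by (auto simp: zero_less_mult_iff mult_less_0_iff)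
  have "{r<..<s} \<subseteq> {t. 0 \<le> p t}"
    by (auto intro!: less_imp_le [of 0] simp: p_pos)
  moreover have "closed {t. 0 \<le> p t}"
    unfolding p_def by (intro closed_Collect_le continuous_intros)
  ultimately have "{r..s} \<subseteq> {t. 0 \<le> p t}"
    using closure_minimal \<open>r < s\<close> by (metis closure_greaterThanLessThan)
  then have "p r = 0" "p s = 0"
    using p_pos [of r] p_pos [of s] \<open>r < s\<close> by (auto simp: subset_eq intro: antisym)
  then have "(s - r) * (b' + c' * (r + s)) = 0"
    unfolding p_def by algebra
  then have "b' = - c' * (r + s)"
    using \<open>r < s\<close> by simp
  then have "a' = c' * (r * s)"
    using \<open>p r = 0\<close> unfolding p_def by algebra
  then show ?thesis
    using Vieta(2) by algebra
qed

lemma herm_form_on_real_line: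
  obtains b where "\<And>t. herm_form e0 (x + t *\<^sub>R y) = herm_form e0 x + b * t + herm_form e0 y * t\<^sup>2"
proof
  show "herm_form e0 (x + t *\<^sub>R y)
      = herm_form e0 x + 2 * (x \<bullet> y - 2 * (x $ e0 \<bullet> y $ e0)) * t + herm_form e0 y * t\<^sup>2" for t
    unfolding herm_form_eq_norm power2_norm_eq_inner
    by (simp add: inner_commute algebra_simps power2_eq_square)
qed

lemma linear_preserving_Dn1_scales_herm_form:
  fixes e0 :: "'n::finite"
  assumes F: "Vector_Spaces.linear (*s) (*s) F"
    and mem_iff: "\<And>z. F z \<in> Dn1 e0 \<longleftrightarrow> z \<in> Dn1 e0"
    and x: "x \<in> Dn1 e0"
  shows "herm_form e0 (F x) = - herm_form e0 (F (axis e0 1)) * herm_form e0 x"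
proof -
  interpret F: Vector_Spaces.linear "(*s)" "(*s)" F
    by (rule F)
  let ?q = "herm_form e0"
  define y :: "complex^'n" where "y = axis e0 1"
  obtain b where q_line: "\<And>t. ?q (x + t *\<^sub>R y) = ?q x + b * t + ?q y * t\<^sup>2"
    using herm_form_on_real_line by blast
  obtain b' where "\<And>t. ?q (F x + t *\<^sub>R F y) = ?q (F x) + b' * t + ?q (F y) * t\<^sup>2"
    using herm_form_on_real_line by blast
  then have q_F_line: "?q (F (x + t *\<^sub>R y)) = ?q (F x) + b' * t + ?q (F y) * t\<^sup>2" for t
    by (simp add: scaleR_eq_scale F.add F.scale)
  have q_y: "?q y = - 1"
    by (simp add: y_def)
  have "?q (F x) * ?q y = ?q x * ?q (F y)"
  proof (rule quadratic_polynomials_proportional)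
    show "0 < ?q x"
      using x by (simp add: Dn1_eq)
    show "0 < ?q x + b * t + ?q y * t\<^sup>2 \<longleftrightarrow> 0 < ?q (F x) + b' * t + ?q (F y) * t\<^sup>2" for t
      using mem_iff [of "x + t *\<^sub>R y"]
      unfolding q_line [symmetric] q_F_line [symmetric] Dn1_eq by simp
  qed (simp add: q_y)
  then show ?thesis
    using q_y unfolding y_def by algebra
qed

text \<open>The Calabi--Markus argument: two hyperplanes meet in codimension at most 2, and the ambient
  dimension is at least 3.\<close>

lemma linear_hyperplane_meets_image:
  fixes e0 :: "'n::finite" and F :: "complex^'n \<Rightarrow> complex^'n"
  assumes "CARD('n) \<ge> 3" and F: "Vector_Spaces.linear (*s) (*s) F"
  obtains w where "norm w = 1" "w $ e0 = 0" "F w $ e0 = 0"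
proof -
  interpret F: Vector_Spaces.linear "(*s)" "(*s)" F
    by (rule F)
  obtain e1 e2 where indices: "e1 \<noteq> e0" "e2 \<noteq> e0" "e2 \<noteq> e1"
    using obtain_two_other_indices [OF assms(1)] .
  define a b where "a = F (axis e1 1) $ e0" and "b = F (axis e2 1) $ e0"
  obtain s t where relation: "s * a + t * b = 0" "s \<noteq> 0 \<or> t \<noteq> 0"
  proof (cases "a = 0")
    case True
    then show ?thesis
      using that [of 1 0] by simp
  next
    case False
    then show ?thesis
      using that [of "- b" a] by simp
  qed
  define v where "v = s *s axis e1 1 + t *s (axis e2 1 :: complex^'n)"
  have "v $ e1 = s" "v $ e2 = t" "v $ e0 = 0"
    using indices by (auto simp: v_def axis_def)
  moreover have "F v $ e0 = 0"
    using relation(1) by (simp add: v_def F.add F.scale a_def b_def)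
  moreover have "v \<noteq> 0"
    using relation(2) calculation(1,2) by auto
  moreover have "F (sgn v) = inverse (norm v) *\<^sub>R F v"
    by (simp only: sgn_div_norm scaleR_eq_scale F.scale)
  ultimately show ?thesis
    using that [of "sgn v"] by (simp add: norm_sgn) (simp add: sgn_div_norm)
qed

lemma Aut_Dn1_multiplier:
  fixes e0 :: "'n::finite"
  assumes card: "CARD('n) \<ge> 3" and f: "f \<in> Aut (Dn1 e0)"
  obtains \<mu> w where "\<And>z. z \<in> Dn1 e0 \<Longrightarrow> herm_form e0 (f z) = \<mu> * herm_form e0 z"
    "norm w = 1" "w $ e0 = 0" "f w $ e0 = 0"
proof -
  obtain F where F: "Vector_Spaces.linear (*s) (*s) F" "\<And>z. F z \<in> Dn1 e0 \<longleftrightarrow> z \<in> Dn1 e0"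
    and F_eq: "\<And>z. z \<in> Dn1 e0 \<Longrightarrow> F z = f z"
    using Aut_Dn1_extends_to_linear [OF assms] by blast
  obtain w where w: "norm w = 1" "w $ e0 = 0" "F w $ e0 = 0"
    using linear_hyperplane_meets_image [OF card F(1)] .
  then have "w \<in> Dn1 e0"
    by (simp add: Dn1_eq herm_form_eq_norm)
  then show ?thesis
    using that [of "- herm_form e0 (F (axis e0 1))" w]
      linear_preserving_Dn1_scales_herm_form [OF F] w by (simp add: F_eq)
qed

section \<open>Properly discontinuous groups\<close>

lemma compact_annulus_in_hyperplane:
  "compact {z :: complex^'n::finite. z $ e0 = 0 \<and> l \<le> (norm z)\<^sup>2 \<and> (norm z)\<^sup>2 \<le> u}" (is "compact ?K")
proof -
  have "closed ?K"
    by (intro closed_Collect_conj closed_Collect_eq closed_Collect_le continuous_intros)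
  moreover have "bounded ?K"
    unfolding bounded_iff by (auto intro!: exI [of _ "sqrt u"] real_le_rsqrt)
  ultimately show ?thesis
    by (simp add: compact_eq_bounded_closed)
qed

lemma finite_multiplier_in_interval:
  fixes e0 :: "'n::finite"
  assumes card: "CARD('n) \<ge> 3" and \<Gamma>: "\<Gamma> \<subseteq> Aut (Dn1 e0)"
    and proper: "properly_discontinuous (Dn1 e0) \<Gamma>" and a_pos: "0 < a"
  shows "finite {g \<in> \<Gamma>. \<exists>z\<in>Dn1 e0. herm_form e0 (g z) / herm_form e0 z \<in> {a..b}}"
    (is "finite ?T")
proof -
  define l u where "l = min 1 a" and "u = max 1 b"
  define K where "K = {z :: complex^'n. z $ e0 = 0 \<and> l \<le> (norm z)\<^sup>2 \<and> (norm z)\<^sup>2 \<le> u}"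
  have "compact K"
    unfolding K_def by (rule compact_annulus_in_hyperplane)
  moreover have "K \<subseteq> Dn1 e0"
    using a_pos by (auto simp: K_def l_def Dn1_eq herm_form_eq_norm)
  ultimately have "finite {g \<in> \<Gamma>. g ` K \<inter> K \<noteq> {}}"
    using proper by (simp add: properly_discontinuous_def)
  moreover have "?T \<subseteq> {g \<in> \<Gamma>. g ` K \<inter> K \<noteq> {}}"
  proof
    fix g assume "g \<in> ?T"
    then obtain z where "g \<in> \<Gamma>"
      and z: "z \<in> Dn1 e0" "herm_form e0 (g z) / herm_form e0 z \<in> {a..b}"
      by blast
    then obtain \<mu> w where \<mu>: "\<And>z. z \<in> Dn1 e0 \<Longrightarrow> herm_form e0 (g z) = \<mu> * herm_form e0 z"
      and w: "norm w = 1" "w $ e0 = 0" "g w $ e0 = 0"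
      using Aut_Dn1_multiplier [OF card] \<Gamma> by blast
    have "\<mu> \<in> {a..b}"
      using z \<mu> [of z] by (simp add: Dn1_eq)
    moreover have "(norm (g w))\<^sup>2 = \<mu>"
      using \<mu> [of w] w by (simp add: Dn1_eq herm_form_eq_norm)
    ultimately have "w \<in> K" "g w \<in> K"
      using w by (auto simp: K_def l_def u_def)
    then show "g \<in> {g \<in> \<Gamma>. g ` K \<inter> K \<noteq> {}}"
      using \<open>g \<in> \<Gamma>\<close> by blast
  qed
  ultimately show ?thesis
    by (rule finite_subset [rotated])
qed

lemma continuous_on_compact_pos_bounds:
  fixes f :: "'a::topological_space \<Rightarrow> real"
  assumes "compact K" "continuous_on K f" and pos: "\<And>x. x \<in> K \<Longrightarrow> 0 < f x"
  obtains a b where "0 < a" "\<And>x. x \<in> K \<Longrightarrow> f x \<in> {a..b}"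
proof -
  have compact_image: "compact (f ` K)"
    using assms(2,1) by (rule compact_continuous_image)
  obtain a where a_le: "0 < a" "\<And>y. y \<in> f ` K \<Longrightarrow> a \<le> dist 0 y"
    using separate_point_closed [OF compact_imp_closed [OF compact_image], of 0] pos by force
  obtain b where norm_le: "\<And>y. y \<in> f ` K \<Longrightarrow> norm y \<le> b"
    using compact_imp_bounded [OF compact_image] by (auto simp: bounded_iff)
  have "f x \<in> {a..b}" if "x \<in> K" for x
    using pos [OF that] a_le(2) [of "f x"] norm_le [of "f x"] that by simp
  then show ?thesis
    using a_le(1) that by blast
qed

lemma finite_compact_meeting_level:
  fixes e0 :: "'n::finite"
  assumes card: "CARD('n) \<ge> 3" and \<Gamma>: "\<Gamma> \<subseteq> Aut (Dn1 e0)"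
    and proper: "properly_discontinuous (Dn1 e0) \<Gamma>"
    and K: "compact K" "K \<subseteq> Dn1 e0" and c_pos: "0 < c"
  shows "finite {g \<in> \<Gamma>. \<exists>y\<in>K. herm_form e0 (g y) = c}"
proof -
  have pos: "0 < c / herm_form e0 y" if "y \<in> K" for y
    using that K(2) c_pos by (auto simp: Dn1_eq)
  then have "continuous_on K (\<lambda>y. c / herm_form e0 y)"
    by (intro continuous_intros) force
  then obtain a b where bounds: "0 < a" "\<And>y. y \<in> K \<Longrightarrow> c / herm_form e0 y \<in> {a..b}"
    using continuous_on_compact_pos_bounds [OF K(1), of "\<lambda>y. c / herm_form e0 y"] pos by blast
  have "finite {g \<in> \<Gamma>. \<exists>z\<in>Dn1 e0. herm_form e0 (g z) / herm_form e0 z \<in> {a..b}}"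
    using finite_multiplier_in_interval [OF card \<Gamma> proper bounds(1)] .
  then show ?thesis
    by (rule rev_finite_subset) (use bounds(2) K(2) in blast)
qed

lemma orbit_map_eq:
  assumes G: "aut_subgroup S G" and g: "g \<in> G" and y: "y \<in> S"
  shows "orbit_map G (g y) = orbit_map G y"
proof
  have subset: "orbit_map G (h x) \<subseteq> orbit_map G x" if "h \<in> G" for h x
    using that G unfolding orbit_map_def aut_subgroup_def by (force intro: exI [of _ "_ \<circ> h"])
  show "orbit_map G (g y) \<subseteq> orbit_map G y"
    by (rule subset [OF g])
  have "homeomorphism S S g (aut_inv S g)"
    using G g by (auto simp: aut_subgroup_def intro: Aut_homeomorphism)
  then have "aut_inv S g (g y) = y"
    using y by (rule homeomorphism_apply1)
  moreover have "aut_inv S g \<in> G"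
    using G g by (simp add: aut_subgroup_def)
  ultimately show "orbit_map G y \<subseteq> orbit_map G (g y)"
    using subset [of "aut_inv S g" "g y"] by simp
qed

lemma orbit_map_eq_iff:
  assumes G: "aut_subgroup S G" and y: "y \<in> S"
  shows "orbit_map G x = orbit_map G y \<longleftrightarrow> (\<exists>g\<in>G. x = g y)"
proof
  have "x \<in> orbit_map G x"
    unfolding orbit_map_def using G by (auto simp: aut_subgroup_def intro: exI [of _ id])
  then show "\<exists>g\<in>G. x = g y" if "orbit_map G x = orbit_map G y"
    using that by (auto simp: orbit_map_def)
qed (use orbit_map_eq [OF G _ y] in auto)

lemma openin_orbit_map_image:
  assumes S: "open S" and G: "aut_subgroup S G"
    and Y: "quotient_map (top_of_set S) Y (orbit_map G)"
    and U: "open U" "U \<subseteq> S"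
  shows "openin Y (orbit_map G ` U)"
proof -
  have hom: "homeomorphism S S g (aut_inv S g)" if "g \<in> G" for g
    using G that by (auto simp: aut_subgroup_def intro: Aut_homeomorphism)
  have "g ` U \<subseteq> S" if "g \<in> G" for g
    using homeomorphism_image1 [OF hom [OF that]] image_mono [OF U(2), of g] by simp
  moreover have "orbit_map G x \<in> orbit_map G ` U \<longleftrightarrow> (\<exists>y\<in>U. \<exists>g\<in>G. x = g y)" for x
    using orbit_map_eq_iff [OF G, of _ x] U(2) by blast
  ultimately have saturation: "{x \<in> S. orbit_map G x \<in> orbit_map G ` U} = (\<Union>g\<in>G. g ` U)"
    by auto
  have "openin (top_of_set S) (g ` U)" if "g \<in> G" for g
    using homeomorphism_imp_open_map [OF hom [OF that]] U by (simp add: openin_open_eq S)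
  then have "openin (top_of_set S) {x \<in> S. orbit_map G x \<in> orbit_map G ` U}"
    unfolding saturation by blast
  moreover have "orbit_map G ` U \<subseteq> topspace Y"
    using quotient_imp_surjective_map [OF Y] U(2) by auto
  ultimately show ?thesis
    using Y by (simp add: quotient_map_def)
qed

lemma compact_quotient_finite_cover:
  assumes S: "open S" and G: "aut_subgroup S G" and cocompact: "compact_quotient S G"
    and V: "\<And>x. x \<in> S \<Longrightarrow> open (V x)" "\<And>x. x \<in> S \<Longrightarrow> V x \<subseteq> S" "\<And>x. x \<in> S \<Longrightarrow> x \<in> V x"
  obtains X where "finite X" "X \<subseteq> S" "S \<subseteq> (\<Union>g\<in>G. g ` (\<Union>x\<in>X. V x))"
proof -
  obtain Y where Y: "quotient_map (top_of_set S) Y (orbit_map G)" "compact_space Y"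
    using cocompact by (auto simp: compact_quotient_def)
  let ?\<V> = "(\<lambda>x. orbit_map G ` V x) ` S"
  have top: "topspace Y = orbit_map G ` S"
    using quotient_imp_surjective_map [OF Y(1)] by simp
  have "\<forall>W\<in>?\<V>. openin Y W"
    using V(1,2) by (auto intro: openin_orbit_map_image [OF S G Y(1)])
  moreover have "topspace Y \<subseteq> \<Union> ?\<V>"
    unfolding top using V(3) by blast
  ultimately obtain \<F> where \<F>: "finite \<F>" "\<F> \<subseteq> ?\<V>" "topspace Y \<subseteq> \<Union> \<F>"
    using Y(2) unfolding compact_space_alt by meson
  then obtain X where X: "finite X" "X \<subseteq> S" "\<F> = (\<lambda>x. orbit_map G ` V x) ` X"
    by (meson finite_subset_image)
  have "S \<subseteq> (\<Union>g\<in>G. g ` (\<Union>x\<in>X. V x))"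
  proof
    fix x assume "x \<in> S"
    then obtain x' y where "x' \<in> X" "y \<in> V x'" "orbit_map G x = orbit_map G y"
      using \<F>(3) by (auto simp: top X(3))
    then show "x \<in> (\<Union>g\<in>G. g ` (\<Union>x\<in>X. V x))"
      using X(2) V(2) orbit_map_eq_iff [OF G, of y x] by blast
  qed
  then show ?thesis
    using X(1,2) that by blast
qed

lemma compact_quotient_imp_compact_cover:
  assumes S: "open S" and G: "aut_subgroup S G" and cocompact: "compact_quotient S G"
  obtains K where "compact K" "K \<subseteq> S" "S \<subseteq> (\<Union>g\<in>G. g ` K)"
proof -
  have "\<forall>x\<in>S. \<exists>r>0. cball x r \<subseteq> S"
    using S open_contains_cball by blast
  then obtain r where r: "\<And>x. x \<in> S \<Longrightarrow> 0 < r x" "\<And>x. x \<in> S \<Longrightarrow> cball x (r x) \<subseteq> S"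
    by metis
  have ball: "ball x (r x) \<subseteq> S" "x \<in> ball x (r x)" if "x \<in> S" for x
    using r [OF that] ball_subset_cball by auto
  obtain X where X: "finite X" "X \<subseteq> S" "S \<subseteq> (\<Union>g\<in>G. g ` (\<Union>x\<in>X. ball x (r x)))"
    by (rule compact_quotient_finite_cover [OF S G cocompact open_ball ball])
  show ?thesis
  proof
    show "compact (\<Union>x\<in>X. cball x (r x))"
      using X(1) by (intro compact_UN) auto
    show "(\<Union>x\<in>X. cball x (r x)) \<subseteq> S"
      using r(2) X(2) by blast
    have "(\<Union>g\<in>G. g ` (\<Union>x\<in>X. ball x (r x))) \<subseteq> (\<Union>g\<in>G. g ` (\<Union>x\<in>X. cball x (r x)))"
      by (intro UN_mono image_mono ball_subset_cball order_refl)
    with X(3) show "S \<subseteq> (\<Union>g\<in>G. g ` (\<Union>x\<in>X. cball x (r x)))"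
      by (rule order_trans)
  qed
qed

lemma unbounded_herm_form_level:
  fixes e0 e1 :: "'n::finite"
  assumes "e1 \<noteq> e0"
  shows "\<not> bounded {z :: complex^'n. herm_form e0 z = c}"
proof
  assume "bounded {z :: complex^'n. herm_form e0 z = c}"
  then obtain B where B: "\<And>z :: complex^'n. herm_form e0 z = c \<Longrightarrow> norm z \<le> B"
    by (auto simp: bounded_iff)
  define t where "t = 1 + \<bar>B\<bar> + \<bar>c\<bar>"
  define x :: "complex^'n" where "x = axis e0 (of_real t) + axis e1 (of_real (sqrt (c + t\<^sup>2)))"
  have x0: "x $ e0 = of_real t"
    using assms by (simp add: x_def axis_def)
  have "1 \<le> t" "\<bar>c\<bar> \<le> t"
    by (auto simp: t_def)
  moreover from this have "t * 1 \<le> t * t"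
    by (intro mult_left_mono) auto
  ultimately have "0 \<le> c + t\<^sup>2"
    unfolding power2_eq_square by linarith
  then have "(norm x)\<^sup>2 = t\<^sup>2 + (c + t\<^sup>2)"
    using assms by (simp add: x_def norm_axis_add_axis)
  then have "herm_form e0 x = c"
    by (simp add: herm_form_eq_norm x0)
  then have "norm x \<le> B"
    by (rule B)
  moreover have "t \<le> norm x"
    using Finite_Cartesian_Product.norm_nth_le [of x e0] by (simp add: x0)
  ultimately show False
    by (simp add: t_def)
qed

lemma compact_image_Aut: "g \<in> Aut S \<Longrightarrow> compact K \<Longrightarrow> K \<subseteq> S \<Longrightarrow> compact (g ` K)"
  unfolding Aut_def
  by (blast intro: compact_continuous_image continuous_on_subset holo_on_imp_continuous_on)

theorem theorem4p1:
  fixes e0 :: "'n::finite" and \<Gamma> :: "(complex^'n \<Rightarrow> complex^'n) set"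
  assumes "CARD('n) \<ge> 3"
  shows "\<not> (aut_subgroup (Dn1 e0) \<Gamma> \<and> discrete_in_aut (Dn1 e0) \<Gamma> \<and>
            properly_discontinuous (Dn1 e0) \<Gamma> \<and> compact_quotient (Dn1 e0) \<Gamma>)"
proof (intro notI, elim conjE)
  assume \<Gamma>: "aut_subgroup (Dn1 e0) \<Gamma>" and proper: "properly_discontinuous (Dn1 e0) \<Gamma>"
    and cocompact: "compact_quotient (Dn1 e0) \<Gamma>"
  have Aut: "\<Gamma> \<subseteq> Aut (Dn1 e0)"
    using \<Gamma> by (simp add: aut_subgroup_def)
  obtain K where K: "compact K" "K \<subseteq> Dn1 e0" and cover: "Dn1 e0 \<subseteq> (\<Union>g\<in>\<Gamma>. g ` K)"
    using compact_quotient_imp_compact_cover [OF open_Dn1 \<Gamma> cocompact] .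
  define T where "T = {g \<in> \<Gamma>. \<exists>y\<in>K. herm_form e0 (g y) = 1}"
  have "compact (\<Union>g\<in>T. g ` K)"
    unfolding T_def using assms Aut proper K
    by (intro compact_UN compact_image_Aut finite_compact_meeting_level) auto
  moreover have "{x. herm_form e0 x = 1} \<subseteq> Dn1 e0"
    by (simp add: Dn1_eq subset_eq)
  then have "{x. herm_form e0 x = 1} \<subseteq> (\<Union>g\<in>T. g ` K)"
    using cover by (fastforce simp: T_def)
  ultimately have "bounded {x. herm_form e0 x = 1}"
    using compact_imp_bounded bounded_subset by blast
  moreover obtain e1 where "e1 \<noteq> e0"
    using obtain_two_other_indices [OF assms] .
  ultimately show False
    using unbounded_herm_form_level by blast
qed

end
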